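(* Let $A$ be a finite non-empty set of agents and $\mathsf{Prop}$ a countable set of propositional variables. For every formula $\varphi$ of the language $\mathcal{L}_{KS}$: if $\vdash_{\mathsf{SSL}}\varphi$, then $\varphi$ is valid on the class of all simplicial secrecy models, i.e. $M,X\Vdash\varphi$ for every simplicial secrecy model $M$ and every facet $X$ of $M$.
   Context: A simplicial complex is a pair $(V,\mathcal{F})$ with $V$ a non-empty set and $\mathcal{F}$ a non-empty family of finite non-empty subsets of $V$ (faces), closed under non-empty subsets. A facet is an inclusion-maximal face; $\mathrm{Fac}$ denotes the set of facets. An $A$-chromatic simplicial complex is $(V,\mathcal{F},\chi)$ with $\chi:V\to A$ injective on every face. An $A$-chromatic simplicial epistemic model is $(V,\mathcal{F},\chi,\nu)$ where $(V,\mathcal{F},\chi)$ is $A$-chromatic, every facet $X$ satisfies $\chi[X]=A$, every vertex lies in some facet, and $\nu:\mathrm{Fac}\to\mathcal{P}(\mathsf{Prop})$. For a facet $X$ and $a\in A$, $v_a(X)$ is the unique vertex of colour $a$ in $X$; for a vertex $v$, $\mathrm{St}(v)=\{X\in\mathrm{Fac}: v\in X\}$; $X\sim_a Y$ iff $v_a(X)=v_a(Y)$. A simplicial secrecy model is $M=(V,\mathcal{F},\chi,\nu,\{N^S_a\}_{a\in A})$ where $(V,\mathcal{F},\chi,\nu)$ is such a model and, with $V_a=\{v:\chi(v)=a\}$, each $N_a^S:V_a\to\mathcal{P}(\mathcal{P}(\mathrm{Fac}(M)))$ satisfies (SN): for every $a$, $v\in V_a$, $U\in N_a^S(v)$, every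 $X\in\mathrm{St}(v)$ and every $b\in A\setminus\{a\}$ there is a facet $Y$ with $X\sim_b Y$ and $Y\notin U$. The language $\mathcal{L}_{KS}$ is $\varphi::=p\mid\neg\varphi\mid(\varphi\wedge\varphi)\mid K_a\varphi\mid S_a\varphi$ ($p\in\mathsf{Prop}$, $a\in A$), with the usual abbreviations. Truth at facets: $M,X\Vdash p$ iff $p\in\nu(X)$; Boolean clauses as usual; $M,X\Vdash K_a\varphi$ iff $M,Y\Vdash\varphi$ for all facets $Y$ with $X\sim_a Y$; $M,X\Vdash S_a\varphi$ iff $M,X\Vdash K_a\varphi$ and $[\![\varphi]\!]\in N_a^S(v_a(X))$, where $[\![\varphi]\!]=\{Y\in\mathrm{Fac}(M):M,Y\Vdash\varphi\}$. The system $\mathsf{SSL}$ has axioms: all propositional tautologies; for each $a\in A$: (K) $K_a(\varphi\to\psi)\to(K_a\varphi\to K_a\psi)$, (T) $K_a\varphi\to\varphi$, (4) $K_a\varphi\to K_aK_a\varphi$, (5) $\neg K_a\varphi\to K_a\neg K_a\varphi$, (S1) $S_a\varphi\to K_a\varphi$, (S4) $S_a\varphi\to K_aS_a\varphi$; and for distinct $a,b\in A$: (S2) $S_a\varphi\to\neg K_b\varphi$. Rules: modus ponens; from $\varphi$ infer $K_a\varphi$; from $\vdash\varphi\leftrightarrow\psi$ infer $\vdash S_a\varphi\leftrightarrow S_a\psi$. *)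

theory Defs
  imports Main "HOL-Library.Countable"
begin

text \<open>The set of agents is the universe of a type \<open>'a\<close> and the set of propositional variables
  the universe of a type \<open>'p\<close>; finiteness and countability are imposed by sort constraints.
  Types are non-empty, which for \<open>'p\<close> only leaves out the case of an empty language.\<close>

datatype ('a, 'p) fm =
    Pro 'p
  | Neg "('a, 'p) fm"
  | Con "('a, 'p) fm" "('a, 'p) fm"
  | Know 'a "('a, 'p) fm"
  | Secret 'a "('a, 'p) fm"

abbreviation Imp :: "('a, 'p) fm \<Rightarrow> ('a, 'p) fm \<Rightarrow> ('a, 'p) fm" where
  "Imp \<phi> \<psi> \<equiv> Neg (Con \<phi> (Neg \<psi>))"

abbreviation Iff :: "('a, 'p) fm \<Rightarrow> ('a, 'p) fm \<Rightarrow> ('a, 'p) fm" where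
  "Iff \<phi> \<psi> \<equiv> Con (Imp \<phi> \<psi>) (Imp \<psi> \<phi>)"

text \<open>Propositional evaluation treats variables and modal formulas alike as atoms, with truth
  values given by \<open>h\<close>; so \<open>tautology\<close> covers all substitution instances of propositional
  tautologies.\<close>

primrec prop_eval :: "(('a, 'p) fm \<Rightarrow> bool) \<Rightarrow> ('a, 'p) fm \<Rightarrow> bool" where
  "prop_eval h (Pro p) \<longleftrightarrow> h (Pro p)"
| "prop_eval h (Neg \<phi>) \<longleftrightarrow> \<not> prop_eval h \<phi>"
| "prop_eval h (Con \<phi> \<psi>) \<longleftrightarrow> prop_eval h \<phi> \<and> prop_eval h \<psi>"
| "prop_eval h (Know a \<phi>) \<longleftrightarrow> h (Know a \<phi>)"
| "prop_eval h (Secret a \<phi>) \<longleftrightarrow> h (Secret a \<phi>)"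

definition tautology :: "('a, 'p) fm \<Rightarrow> bool" where
  "tautology \<phi> \<longleftrightarrow> (\<forall>h. prop_eval h \<phi>)"

inductive SSL :: "('a, 'p) fm \<Rightarrow> bool" (\<open>\<turnstile>\<^sub>S\<^sub>S\<^sub>L _\<close> [50] 50) where
  Taut: "tautology \<phi> \<Longrightarrow> \<turnstile>\<^sub>S\<^sub>S\<^sub>L \<phi>"
| AxK: "\<turnstile>\<^sub>S\<^sub>S\<^sub>L Imp (Know a (Imp \<phi> \<psi>)) (Imp (Know a \<phi>) (Know a \<psi>))"
| AxT: "\<turnstile>\<^sub>S\<^sub>S\<^sub>L Imp (Know a \<phi>) \<phi>"
| Ax4: "\<turnstile>\<^sub>S\<^sub>S\<^sub>L Imp (Know a \<phi>) (Know a (Know a \<phi>))"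
| Ax5: "\<turnstile>\<^sub>S\<^sub>S\<^sub>L Imp (Neg (Know a \<phi>)) (Know a (Neg (Know a \<phi>)))"
| AxS1: "\<turnstile>\<^sub>S\<^sub>S\<^sub>L Imp (Secret a \<phi>) (Know a \<phi>)"
| AxS4: "\<turnstile>\<^sub>S\<^sub>S\<^sub>L Imp (Secret a \<phi>) (Know a (Secret a \<phi>))"
| AxS2: "a \<noteq> b \<Longrightarrow> \<turnstile>\<^sub>S\<^sub>S\<^sub>L Imp (Secret a \<phi>) (Neg (Know b \<phi>))"
| MP: "\<turnstile>\<^sub>S\<^sub>S\<^sub>L \<phi> \<Longrightarrow> \<turnstile>\<^sub>S\<^sub>S\<^sub>L Imp \<phi> \<psi> \<Longrightarrow> \<turnstile>\<^sub>S\<^sub>S\<^sub>L \<psi>"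
| Nec: "\<turnstile>\<^sub>S\<^sub>S\<^sub>L \<phi> \<Longrightarrow> \<turnstile>\<^sub>S\<^sub>S\<^sub>L Know a \<phi>"
| RE: "\<turnstile>\<^sub>S\<^sub>S\<^sub>L Iff \<phi> \<psi> \<Longrightarrow> \<turnstile>\<^sub>S\<^sub>S\<^sub>L Iff (Secret a \<phi>) (Secret a \<psi>)"

record 'v cplx =
  verts :: "'v set"
  faces :: "'v set set"

record ('v, 'a) chromatic_cplx = "'v cplx" +
  colour :: "'v \<Rightarrow> 'a"

record ('v, 'a, 'p) epistemic_model = "('v, 'a) chromatic_cplx" +
  val :: "'v set \<Rightarrow> 'p set"

record ('v, 'a, 'p) secrecy_model = "('v, 'a, 'p) epistemic_model" +
  nbhd :: "'a \<Rightarrow> 'v \<Rightarrow> 'v set set set"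

definition simplicial_complex :: "('v, 'z) cplx_scheme \<Rightarrow> bool" where
  "simplicial_complex C \<longleftrightarrow>
     verts C \<noteq> {} \<and> faces C \<noteq> {} \<and>
     (\<forall>X \<in> faces C. X \<subseteq> verts C \<and> finite X \<and> X \<noteq> {}) \<and>
     (\<forall>X \<in> faces C. \<forall>Y. Y \<subseteq> X \<longrightarrow> Y \<noteq> {} \<longrightarrow> Y \<in> faces C)"

definition facets :: "('v, 'z) cplx_scheme \<Rightarrow> 'v set set" where
  "facets C = {X \<in> faces C. \<forall>Y \<in> faces C. X \<subseteq> Y \<longrightarrow> Y = X}"

definition star :: "('v, 'z) cplx_scheme \<Rightarrow> 'v \<Rightarrow> 'v set set" where
  "star C v = {X \<in> facets C. v \<in> X}"

definition chromatic_complex :: "('v, 'a, 'z) chromatic_cplx_scheme \<Rightarrow> bool" where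
  "chromatic_complex C \<longleftrightarrow>
     simplicial_complex C \<and> (\<forall>X \<in> faces C. inj_on (colour C) X)"

definition colour_class :: "('v, 'a, 'z) chromatic_cplx_scheme \<Rightarrow> 'a \<Rightarrow> 'v set" where
  "colour_class C a = {v \<in> verts C. colour C v = a}"

definition vertex_of :: "('v, 'a, 'z) chromatic_cplx_scheme \<Rightarrow> 'a \<Rightarrow> 'v set \<Rightarrow> 'v" where
  "vertex_of C a X = (THE v. v \<in> X \<and> colour C v = a)"

definition indist :: "('v, 'a, 'z) chromatic_cplx_scheme \<Rightarrow> 'a \<Rightarrow> 'v set \<Rightarrow> 'v set \<Rightarrow> bool" where
  "indist C a X Y \<longleftrightarrow> vertex_of C a X = vertex_of C a Y"

definition simplicial_epistemic_model :: "('v, 'a, 'p, 'z) epistemic_model_scheme \<Rightarrow> bool" where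
  "simplicial_epistemic_model M \<longleftrightarrow>
     chromatic_complex M \<and>
     (\<forall>X \<in> facets M. colour M ` X = UNIV) \<and>
     (\<forall>v \<in> verts M. \<exists>X \<in> facets M. v \<in> X)"

text \<open>The fields \<open>colour\<close>, \<open>val\<close> and \<open>nbhd\<close> are total functions; only their values on vertices,
  on facets and, for \<open>nbhd M a\<close>, on vertices of colour \<open>a\<close> are meaningful.\<close>

definition simplicial_secrecy_model :: "('v, 'a, 'p, 'z) secrecy_model_scheme \<Rightarrow> bool" where
  "simplicial_secrecy_model M \<longleftrightarrow>
     simplicial_epistemic_model M \<and>
     (\<forall>a. \<forall>v \<in> colour_class M a. nbhd M a v \<subseteq> Pow (facets M)) \<and>
     (\<forall>a. \<forall>v \<in> colour_class M a. \<forall>U \<in> nbhd M a v. \<forall>X \<in> star M v. \<forall>b. b \<noteq> a \<longrightarrow>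
        (\<exists>Y \<in> facets M. indist M b X Y \<and> Y \<notin> U))"

primrec sat :: "('v, 'a, 'p, 'z) secrecy_model_scheme \<Rightarrow> 'v set \<Rightarrow> ('a, 'p) fm \<Rightarrow> bool"
    (\<open>_, _ \<tturnstile> _\<close> [51, 51, 51] 50) where
  "M, X \<tturnstile> Pro p \<longleftrightarrow> p \<in> val M X"
| "M, X \<tturnstile> Neg \<phi> \<longleftrightarrow> \<not> (M, X \<tturnstile> \<phi>)"
| "M, X \<tturnstile> Con \<phi> \<psi> \<longleftrightarrow> (M, X \<tturnstile> \<phi>) \<and> (M, X \<tturnstile> \<psi>)"
| "M, X \<tturnstile> Know a \<phi> \<longleftrightarrow> (\<forall>Y \<in> facets M. indist M a X Y \<longrightarrow> (M, Y \<tturnstile> \<phi>))"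
| "M, X \<tturnstile> Secret a \<phi> \<longleftrightarrow>
     (\<forall>Y \<in> facets M. indist M a X Y \<longrightarrow> (M, Y \<tturnstile> \<phi>)) \<and>
     {Y \<in> facets M. M, Y \<tturnstile> \<phi>} \<in> nbhd M a (vertex_of M a X)"

end

theory Submission imports Defs begin

text \<open>Soundness is an induction on derivations in a fixed model. Since
  \<open>indist M a\<close> is equality of a-coloured vertices, it is an equivalence relation, which
  gives T, 4 and 5. S1 is built into the truth clause of \<open>Secret\<close>, and S4 holds because
  that clause depends on the facet only through its a-vertex. The rule for equivalents under S holds
  because neighbourhoods see only truth sets. The semantic condition (SN) is needed just for S2, in
  \<open>Secret_imp_not_Know\<close>.\<close>

lemma prop_eval_sat: "prop_eval (\<lambda>\<psi>. M, X \<tturnstile> \<psi>) \<phi> \<longleftrightarrow> M, X \<tturnstile> \<phi>"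
  by (induction \<phi>) simp_all

lemma tautology_sat: "tautology \<phi> \<Longrightarrow> M, X \<tturnstile> \<phi>"
  by (metis prop_eval_sat tautology_def)

text \<open>The colouring of a facet is onto the agents and injective, so the description in
  \<open>vertex_of\<close> denotes a unique vertex.\<close>

lemma vertex_of_facet:
  assumes "simplicial_epistemic_model M" and "X \<in> facets M"
  shows "vertex_of M a X \<in> X" and "colour M (vertex_of M a X) = a"
proof -
  have "colour M ` X = UNIV" and "inj_on (colour M) X"
    using assms
    by (auto simp: simplicial_epistemic_model_def chromatic_complex_def facets_def)
  then have "\<exists>!v. v \<in> X \<and> colour M v = a"
    by (auto simp: inj_on_def) (metis UNIV_I imageE)
  from theI'[OF this] show "vertex_of M a X \<in> X" and "colour M (vertex_of M a X) = a"
    by (simp_all add: vertex_of_def)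
qed

lemma vertex_of_facet_colour_class:
  assumes "simplicial_epistemic_model M" and "X \<in> facets M"
  shows "vertex_of M a X \<in> colour_class M a"
proof -
  have "X \<subseteq> verts M"
    using assms by (auto simp: simplicial_epistemic_model_def chromatic_complex_def
      simplicial_complex_def facets_def)
  then show ?thesis
    using vertex_of_facet[OF assms] by (auto simp: colour_class_def)
qed

text \<open>Apply (SN) at the a-vertex of X to the truth set of \<phi>: some facet that b cannot
  tell from X lies outside this set, hence refutes \<phi>.\<close>

lemma Secret_imp_not_Know:
  assumes M: "simplicial_secrecy_model M" and X: "X \<in> facets M"
    and secret: "M, X \<tturnstile> Secret a \<phi>" and "a \<noteq> b"
  shows "\<not> (M, X \<tturnstile> Know b \<phi>)"
proof -
  have E: "simplicial_epistemic_model M"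
    using M by (simp add: simplicial_secrecy_model_def)
  let ?v = "vertex_of M a X" and ?U = "{Y \<in> facets M. M, Y \<tturnstile> \<phi>}"
  have "?v \<in> colour_class M a" and "X \<in> star M ?v"
    using vertex_of_facet_colour_class[OF E X] vertex_of_facet[OF E X] X
    by (auto simp: star_def)
  moreover have "?U \<in> nbhd M a ?v"
    using secret by simp
  ultimately obtain Y where "Y \<in> facets M" "indist M b X Y" "Y \<notin> ?U"
    using M \<open>a \<noteq> b\<close>[symmetric] unfolding simplicial_secrecy_model_def by blast
  then show ?thesis by auto
qed

lemma SSL_sound:
  fixes M :: "('v, 'a, 'p, 'z) secrecy_model_scheme"
  assumes "\<turnstile>\<^sub>S\<^sub>S\<^sub>L \<phi>" and M: "simplicial_secrecy_model M" and "X \<in> facets M"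
  shows "M, X \<tturnstile> \<phi>"
  using assms(1,3)
\<comment> \<open>\<open>Nec\<close> and \<open>RE\<close> use the induction hypothesis at facets
  other than X.\<close>
proof (induction arbitrary: X rule: SSL.induct)
  case (Taut \<phi>)
  then show ?case by (simp only: tautology_sat)
next
  case (AxT a \<phi>)
  then show ?case unfolding sat.simps indist_def by blast
next
  case (Ax4 a \<phi>)
  show ?case unfolding sat.simps indist_def by metis
next
  case (Ax5 a \<phi>)
  show ?case unfolding sat.simps indist_def by metis
next
  case (AxS4 a \<phi>)
  \<comment> \<open>Both conjuncts mention X only through \<open>vertex_of M a X\<close>, so they
    transfer to every facet with the same a-vertex.\<close>
  show ?case unfolding sat.simps indist_def by metis
next
  case (AxS2 a b \<phi>)
  show ?case
    using Secret_imp_not_Know[OF M AxS2.prems _ AxS2.hyps] unfolding sat.simps(2,3) by blast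
next
  case (RE \<phi> \<psi> a)
  \<comment> \<open>Truth sets contain only facets, so agreement on facets makes them equal.\<close>
  have eq: "M, Y \<tturnstile> \<phi> \<longleftrightarrow> M, Y \<tturnstile> \<psi>" if "Y \<in> facets M" for Y
    using RE.IH[OF that] unfolding sat.simps by blast
  then have "{Y \<in> facets M. M, Y \<tturnstile> \<phi>} = {Y \<in> facets M. M, Y \<tturnstile> \<psi>}"
    by blast
  then show ?case using eq unfolding sat.simps by auto
\<comment> \<open>Left are \<open>AxK\<close>, \<open>AxS1\<close>, \<open>MP\<close> and
  \<open>Nec\<close>, immediate from the truth clauses.\<close>
qed (unfold sat.simps, blast+)

theorem theorem5p3:
  fixes \<phi> :: "('a::finite, 'p::countable) fm"
  assumes "\<turnstile>\<^sub>S\<^sub>S\<^sub>L \<phi>"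
  shows "\<forall>(M :: ('v, 'a, 'p) secrecy_model) X.
    simplicial_secrecy_model M \<longrightarrow> X \<in> facets M \<longrightarrow> M, X \<tturnstile> \<phi>"
  using SSL_sound[OF assms] by blast

end
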